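(* The Shrikhande graph (on 16 vertices and 48 edges) is not word-representable.
   Context: Graphs are finite, simple and undirected. Two distinct letters $x$ and $y$ alternate in a word $w$ if after deleting from $w$ all letters except the copies of $x$ and $y$ one obtains either a word $xyxy\cdots$ (of even or odd length) or a word $yxyx\cdots$ (of even or odd length). A graph $G=(V,E)$ is word-representable if there exists a (finite) word $w$ over the alphabet $V$, in which each letter of $V$ occurs at least once, such that for all distinct $x,y\in V$, the letters $x$ and $y$ alternate in $w$ if and only if $xy\in E$. The Shrikhande graph is the graph with vertex set $\{1,2,\ldots,16\}$ and the following 48 edges (written $a$-$b$): 1-2, 2-3, 3-4, 1-4; 1-5, 1-9, 1-8, 1-12; 2-5, 2-9, 2-6, 2-10; 3-6, 3-7, 3-10, 3-11; 4-8, 4-7, 4-12, 4-11; 8-9, 6-9, 6-11, 8-11; 5-10, 7-10, 7-12, 5-12; 13-14, 14-15, 15-16, 13-16; 5-13, 5-14, 11-13, 11-14; 9-15, 9-16, 7-15, 7-16; 8-13, 8-16, 10-13, 10-16; 6-14, 6-15, 12-14, 12-15. *)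

theory Defs
  imports "Graph_Theory.Pair_Digraph"
begin

text \<open>Following Graph\_Theory, a finite simple undirected graph is a \<^locale>\<open>pair_graph\<close>:
  the edge joining \<open>x\<close> and \<open>y\<close> is the pair of arcs \<open>(x, y)\<close> and \<open>(y, x)\<close>.\<close>

text \<open>The word \<open>xyxy\<dots>\<close> of a given length, even or odd.\<close>

primrec alternating_word :: "'a \<Rightarrow> 'a \<Rightarrow> nat \<Rightarrow> 'a list" where
  "alternating_word x y 0 = []"
| "alternating_word x y (Suc n) = x # alternating_word y x n"

definition alternate :: "'a \<Rightarrow> 'a \<Rightarrow> 'a list \<Rightarrow> bool" where
  "alternate x y w \<longleftrightarrow>
     (\<exists>n. filter (\<lambda>z. z = x \<or> z = y) w = alternating_word x y n \<or>
          filter (\<lambda>z. z = x \<or> z = y) w = alternating_word y x n)"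

definition word_representable :: "'a pair_pre_digraph \<Rightarrow> bool" where
  "word_representable G \<longleftrightarrow>
     (\<exists>w. set w = pverts G \<and>
          (\<forall>x\<in>pverts G. \<forall>y\<in>pverts G. x \<noteq> y \<longrightarrow> (alternate x y w \<longleftrightarrow> (x, y) \<in> parcs G)))"

definition shrikhande_edges :: "(nat \<times> nat) list" where
  "shrikhande_edges =
    [(1,2), (2,3), (3,4), (1,4),
     (1,5), (1,9), (1,8), (1,12),
     (2,5), (2,9), (2,6), (2,10),
     (3,6), (3,7), (3,10), (3,11),
     (4,8), (4,7), (4,12), (4,11),
     (8,9), (6,9), (6,11), (8,11),
     (5,10), (7,10), (7,12), (5,12),
     (13,14), (14,15), (15,16), (13,16),
     (5,13), (5,14), (11,13), (11,14),
     (9,15), (9,16), (7,15), (7,16),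
     (8,13), (8,16), (10,13), (10,16),
     (6,14), (6,15), (12,14), (12,15)]"

definition shrikhande :: "nat pair_pre_digraph" where
  "shrikhande = \<lparr> pverts = {1..16}, parcs = set shrikhande_edges \<union> (set shrikhande_edges)\<inverse> \<rparr>"

lemma pair_graph_shrikhande: "pair_graph shrikhande"
proof
  have edge: "1 \<le> fst e \<and> fst e \<le> 16 \<and> 1 \<le> snd e \<and> snd e \<le> 16 \<and> fst e \<noteq> snd e"
    if "e \<in> parcs shrikhande" for e
    using that unfolding shrikhande_def shrikhande_edges_def by auto
  show "fst e \<in> pverts shrikhande" "snd e \<in> pverts shrikhande" "fst e \<noteq> snd e"
    if "e \<in> parcs shrikhande" for e
    using edge[OF that] by (simp_all add: shrikhande_def)
  show "finite (pverts shrikhande)" "finite (parcs shrikhande)"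
    by (simp_all add: shrikhande_def)
  show "symmetric (with_proj shrikhande)"
    by (auto simp: symmetric_def shrikhande_def intro: symI)
qed

lemma card_verts_shrikhande: "card (pverts shrikhande) = 16"
  by (simp add: shrikhande_def)

lemma card_edges_shrikhande: "card ((\<lambda>(x, y). {x, y}) ` parcs shrikhande) = 48"
proof -
  have "(\<lambda>(x, y). {x, y}) ` parcs shrikhande = (\<lambda>(x, y). {x, y}) ` set shrikhande_edges"
    by (auto simp: shrikhande_def image_iff insert_commute)
  moreover have "inj_on (\<lambda>(x, y). {x, y}) (set shrikhande_edges)"
  proof (rule inj_onI)
    have lt: "fst e < snd e" if "e \<in> set shrikhande_edges" for e
      using that unfolding shrikhande_edges_def by auto
    fix e f assume "e \<in> set shrikhande_edges" "f \<in> set shrikhande_edges"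
      and "(case e of (x, y) \<Rightarrow> {x, y}) = (case f of (x, y) \<Rightarrow> {x, y})"
    with lt[of e] lt[of f] show "e = f"
      by (auto simp: doubleton_eq_iff split: prod.splits)
  qed
  moreover have "card (set shrikhande_edges) = 48"
  proof -
    have "distinct shrikhande_edges" "length shrikhande_edges = 48"
      by (simp_all add: shrikhande_edges_def)
    then show ?thesis by (simp add: distinct_card)
  qed
  ultimately show ?thesis by (simp add: card_image)
qed

end

theory Submission
  imports Defs
begin

text \<open>Comparing, prefix by prefix, how often two letters have occurred orients the edges of a
  word-representable graph so that no directed path of length 3 lies in a 4-cycle, unless the cycle
  spans a complete graph. Without \<open>K\<^sub>4\<close>, the signs of the four edges
  of each 4-cycle therefore sum to zero when read around it. In the Shrikhande graph, four times the
  boundary of a triangle is an integer combination of 4-cycles; so the three signs around that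
  triangle also sum to zero, which is impossible for an odd number of signs.\<close>

text \<open>Induction on the word: a leading \<open>x\<close> raises every later count of
  \<open>x\<close> by one, which turns the two bounds into those for the swapped pair
  \<open>y\<close>, \<open>x\<close>; a leading \<open>y\<close> breaks the first bound at
  once.\<close>

lemma alternating_word_iff_count_list:
  assumes "x \<noteq> y"
  shows "(\<exists>n. filter (\<lambda>z. z = x \<or> z = y) w = alternating_word x y n) \<longleftrightarrow>
    (\<forall>k. count_list (take k w) y \<le> count_list (take k w) x \<and>
         count_list (take k w) x \<le> Suc (count_list (take k w) y))"
  using assms
proof (induction w arbitrary: x y)
  case Nil
  have "[] = alternating_word x y 0" by simp
  then show ?case by (metis count_list.simps(1) filter.simps(1) le_SucI le_refl take_Nil)
next
  case (Cons a w)
  have all_nat: "(\<forall>k. P k) \<longleftrightarrow> P 0 \<and> (\<forall>k. P (Suc k))" for P :: "nat \<Rightarrow> bool"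
    by (metis not0_implies_Suc)
  have ex_nat: "(\<exists>k. P k) \<longleftrightarrow> P 0 \<or> (\<exists>k. P (Suc k))" for P :: "nat \<Rightarrow> bool"
    by (metis not0_implies_Suc)
  consider "a = x" | "a = y" | "a \<noteq> x" "a \<noteq> y" by blast
  then show ?case
  proof cases
    case 1
    then show ?thesis
      using Cons.IH[of y x] Cons.prems
      by (subst ex_nat, subst all_nat) (auto simp: disj_commute)
  next
    case 2
    have "\<not> (\<exists>n. filter (\<lambda>z. z = x \<or> z = y) (a # w) = alternating_word x y n)"
      using 2 Cons.prems by (subst ex_nat) auto
    moreover have "count_list (take 1 (a # w)) x < count_list (take 1 (a # w)) y"
      using 2 Cons.prems by simp
    ultimately show ?thesis by (meson not_le)
  next
    case 3
    then show ?thesis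
      using Cons.IH[of x y] Cons.prems by (subst all_nat) auto
  qed
qed

definition ahead :: "'a list \<Rightarrow> 'a \<Rightarrow> 'a \<Rightarrow> bool" where
  "ahead w x y \<longleftrightarrow> (\<forall>k. count_list (take k w) y \<le> count_list (take k w) x)"

lemma ahead_trans: "ahead w x y \<Longrightarrow> ahead w y z \<Longrightarrow> ahead w x z"
  unfolding ahead_def using le_trans by blast

lemma alternate_iff_ahead:
  assumes "x \<noteq> y"
  shows "alternate x y w \<longleftrightarrow>
    ahead w x y \<and> (\<forall>k. count_list (take k w) x \<le> Suc (count_list (take k w) y)) \<or>
    ahead w y x \<and> (\<forall>k. count_list (take k w) y \<le> Suc (count_list (take k w) x))"
  using alternating_word_iff_count_list[OF assms, of w]
    alternating_word_iff_count_list[OF assms[symmetric], of w]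
  unfolding alternate_def ahead_def by (auto simp: disj_commute ex_disj_distrib)

text \<open>Equal counts on all prefixes fail at an occurrence of \<open>x\<close>, which raises the
  count of \<open>x\<close> alone.\<close>

lemma ahead_antisym:
  assumes "x \<in> set w" "ahead w x y" "ahead w y x"
  shows "x = y"
proof (rule ccontr)
  assume "x \<noteq> y"
  obtain us vs where w: "w = us @ x # vs" using assms(1) by (meson split_list)
  have eq: "count_list (take k w) x = count_list (take k w) y" for k
    using assms(2,3) by (simp add: ahead_def antisym)
  show False
    using eq[of "length us"] eq[of "Suc (length us)"] \<open>x \<noteq> y\<close> by (simp add: w)
qed

lemma alternate_commute: "alternate x y w \<longleftrightarrow> alternate y x w"
  by (simp add: alternate_def disj_commute)

text \<open>Each edge gets exactly one orientation: alternation gives at least one, antisymmetry at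
  most one.\<close>

lemma alternate_ahead_iff:
  assumes "alternate x y w" "x \<in> set w" "x \<noteq> y"
  shows "ahead w y x \<longleftrightarrow> \<not> ahead w x y"
  using assms ahead_antisym alternate_iff_ahead by metis

text \<open>On every prefix, the count of \<open>x\<close> exceeds that of \<open>u\<close> by at most one,
  so the same holds for any two letters between them.\<close>

lemma alternate_between:
  assumes "alternate x u w" "x \<in> set w" "x \<noteq> u" "y \<noteq> z"
    and "ahead w x y" "ahead w y z" "ahead w z u"
  shows "alternate y z w"
proof -
  have "ahead w x u" using assms(5-7) ahead_trans by metis
  \<comment> \<open>This excludes the disjunct of \<open>alternate_iff_ahead\<close> in which
    \<open>u\<close> leads.\<close>
  then have "\<not> ahead w u x" using ahead_antisym assms(2,3) by metis
  then have *: "count_list (take k w) x \<le> Suc (count_list (take k w) u)" for k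
    using assms(1,3) by (simp add: alternate_iff_ahead)
  have "count_list (take k w) y \<le> Suc (count_list (take k w) z)" for k
    using *[of k] assms(5,7) unfolding ahead_def by (meson Suc_le_mono le_trans)
  then show ?thesis using assms(4,6) by (simp add: alternate_iff_ahead)
qed

definition lead :: "'a list \<Rightarrow> 'a \<Rightarrow> 'a \<Rightarrow> int" where
  "lead w x y = (if ahead w x y then 1 else - 1)"

lemma lead_skew:
  assumes "alternate x y w" "x \<in> set w" "x \<noteq> y"
  shows "lead w y x = - lead w x y"
  using alternate_ahead_iff[OF assms] by (simp add: lead_def)

text \<open>Along such a path both diagonals lie between \<open>x\<close> and \<open>u\<close>, so
  \<open>alternate_between\<close> would make both of them edges.\<close>

lemma no_ahead_path_in_four_cycle:
  assumes "alternate x u w" "x \<in> set w" "distinct [x, y, z, u]"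
    and "\<not> (alternate x z w \<and> alternate y u w)"
  shows "\<not> (ahead w x y \<and> ahead w y z \<and> ahead w z u)"
proof
  assume *: "ahead w x y \<and> ahead w y z \<and> ahead w z u"
  \<comment> \<open>Each diagonal shares an endpoint with the pair \<open>x\<close>,
    \<open>u\<close>, so one link of the chain is trivial.\<close>
  have refl: "ahead w a a" for a by (simp add: ahead_def)
  have "alternate x z w"
    by (rule alternate_between[of x u w x z]) (use * assms refl ahead_trans in force)+
  moreover have "alternate y u w"
    by (rule alternate_between[of x u w y u]) (use * assms refl ahead_trans in force)+
  ultimately show False using assms(4) by blast
qed

text \<open>If four signs do not sum to zero, at least three agree; any three edges of a 4-cycle
  form a path, which would then be directed. The eight excluded paths are four starting points in
  two directions.\<close>

lemma lead_four_cycle: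
  assumes "distinct [x, y, z, u]" "{x, y, z, u} \<subseteq> set w"
    and "alternate x y w" "alternate y z w" "alternate z u w" "alternate u x w"
    and "\<not> (alternate x z w \<and> alternate y u w)"
  shows "lead w x y + lead w y z + lead w z u + lead w u x = 0"
proof -
  note path = no_ahead_path_in_four_cycle[of _ _ w]
  have comm: "alternate y x w" "alternate z y w" "alternate u z w" "alternate x u w"
    "alternate z x w \<longleftrightarrow> alternate x z w" "alternate u y w \<longleftrightarrow> alternate y u w"
    using assms(3-6) alternate_commute by metis+
  have swap: "ahead w y x \<longleftrightarrow> \<not> ahead w x y" "ahead w z y \<longleftrightarrow> \<not> ahead w y z"
    "ahead w u z \<longleftrightarrow> \<not> ahead w z u" "ahead w x u \<longleftrightarrow> \<not> ahead w u x"
    using assms comm(4) alternate_ahead_iff[of x u w] by (simp_all add: alternate_ahead_iff)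
  have "\<not> (ahead w x y \<and> ahead w y z \<and> ahead w z u)" "\<not> (ahead w y z \<and> ahead w z u \<and> ahead w u x)"
    "\<not> (ahead w z u \<and> ahead w u x \<and> ahead w x y)" "\<not> (ahead w u x \<and> ahead w x y \<and> ahead w y z)"
    "\<not> (ahead w u z \<and> ahead w z y \<and> ahead w y x)" "\<not> (ahead w x u \<and> ahead w u z \<and> ahead w z y)"
    "\<not> (ahead w y x \<and> ahead w x u \<and> ahead w u z)" "\<not> (ahead w z y \<and> ahead w y x \<and> ahead w x u)"
    by (rule path; use assms comm in auto)+
  then show ?thesis
    unfolding swap by (auto simp: lead_def)
qed

theorem mainTheorem2:
  shows "\<not> word_representable shrikhande"
proof
  assume "word_representable shrikhande"
  then obtain w where w: "set w = pverts shrikhande" and alt: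
    "\<And>x y. x \<in> pverts shrikhande \<Longrightarrow> y \<in> pverts shrikhande \<Longrightarrow> x \<noteq> y \<Longrightarrow>
      alternate x y w \<longleftrightarrow> (x, y) \<in> parcs shrikhande"
    unfolding word_representable_def by blast
  define s where "s = lead w"
  have skew: "s y x = - s x y" if "(x, y) \<in> set shrikhande_edges" for x y
  proof -
    interpret pair_graph shrikhande by (rule pair_graph_shrikhande)
    have arc: "(x, y) \<in> parcs shrikhande" using that by (simp add: shrikhande_def)
    then have "x \<in> pverts shrikhande" "y \<in> pverts shrikhande" "x \<noteq> y"
      using in_arcsD1 in_arcsD2 no_loops by force+
    then show ?thesis using arc alt w by (simp add: s_def lead_skew)
  qed
  \<comment> \<open>One diagonal may be an edge, so two triangles glued along an edge qualify, such
    as 1, 8, 4, 12 with diagonal 1-4.\<close>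
  have four_cycle: "s x y + s y z + s z u + s u x = 0"
    if "distinct [x, y, z, u]" "{x, y, z, u} \<subseteq> pverts shrikhande"
      "{(x, y), (y, z), (z, u), (u, x)} \<subseteq> parcs shrikhande"
      "\<not> {(x, z), (y, u)} \<subseteq> parcs shrikhande" for x y z u
    unfolding s_def by (rule lead_four_cycle) (use that alt w in auto)
  \<comment> \<open>Taken in this order with coefficients 1, 1, 2, 1, 1, -2, 1, -1, 1, -1, 1, -1, 1,
    these equations cancel by skew-symmetry on every edge outside the triangle 1, 4, 12 and leave
    four times its boundary.\<close>
  have
    "s 1 5 + s 5 13 + s 13 8 + s 8 1 = 0" "s 1 8 + s 8 4 + s 4 12 + s 12 1 = 0"
    "s 1 4 + s 4 7 + s 7 12 + s 12 1 = 0" "s 1 4 + s 4 8 + s 8 9 + s 9 1 = 0"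
    "s 1 9 + s 9 15 + s 15 12 + s 12 1 = 0" "s 4 7 + s 7 15 + s 15 12 + s 12 4 = 0"
    "s 1 4 + s 4 12 + s 12 5 + s 5 1 = 0" "s 8 9 + s 9 16 + s 16 13 + s 13 8 = 0"
    "s 13 14 + s 14 15 + s 15 16 + s 16 13 = 0" "s 7 12 + s 12 14 + s 14 15 + s 15 7 = 0"
    "s 7 15 + s 15 9 + s 9 16 + s 16 7 = 0" "s 7 12 + s 12 15 + s 15 16 + s 16 7 = 0"
    "s 5 12 + s 12 14 + s 14 13 + s 13 5 = 0"
    by (rule four_cycle; simp add: shrikhande_def shrikhande_edges_def)+
  moreover have "\<forall>(x, y) \<in> set shrikhande_edges. s y x = - s x y"
    using skew by blast
  ultimately have "s 1 4 + s 4 12 + s 12 1 = 0"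
    unfolding shrikhande_edges_def by simp
  then show False
    by (auto simp: s_def lead_def split: if_splits)
qed

end
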